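(* Assume that each $S_\lambda$, $\lambda\in\Lambda$, is a semigroup of transition kernels of a stochastic process, i.e. there are $M$-valued random variables $X_t^{\lambda,x}$ such that $(S_\lambda(t)u)(x)=\mathbb{E}[u(X_t^{\lambda,x})]$ for all $x\in M$, $\lambda\in\Lambda$, $t\ge0$ and $u\in\mathrm{UC}_\kappa$. Then, for all $t\ge0$, $u\in\mathrm{UC}_\kappa$ and $x\in M$, $$(\mathscr{S}(t)u)(x)=\sup_{\lambda\in\Lambda_{\rm ad}^t}(J_\lambda u)(x).$$
   Context: Setting: $\Lambda$ is a nonempty set, $(M,d)$ is a separable metric space with Borel $\sigma$-algebra $\mathcal{B}$, and $\kappa\colon M\to(0,\infty)$ is continuous and bounded. $\|u\|_\infty=\sup_{x\in M}|u(x)|$; $\|u\|_\kappa=\|\kappa u\|_\infty$; $\|u\|_{\mathrm{Lip}}=\inf\{L\ge 0: |u(x)-u(y)|\le L d(x,y)\ \forall x,y\in M\}$. $\mathrm{C}_\kappa$ is the space of continuous $u\colon M\to\mathbb{R}$ with $\|u\|_\kappa<\infty$; $\mathrm{Lip}_{\rm b}$ is the space of bounded Lipschitz functions $M\to\mathbb{R}$; $\mathrm{UC}_\kappa$ is the closure of $\mathrm{Lip}_{\rm b}$ in $(\mathrm{C}_\kappa,\|\cdot\|_\kappa)$. For $u_n,u\in\mathrm{UC}_\kappa$, $u_n\nearrow u$ means $u_n\le u_{n+1}$ for all $n$ and $u_n(x)\to u(x)$ for all $x\in M$. A Feller semigroup is a family $T=(T(t))_{t\ge0}$ of possibly nonlinear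 operators such that (i) $T(t)\colon\mathrm{UC}_\kappa\to\mathrm{UC}_\kappa$ is continuous for all $t\ge 0$; (ii) $T(0)u=u$ and $T(s+t)u=T(s)T(t)u$ for all $s,t\ge0$, $u\in\mathrm{UC}_\kappa$; (iii) each $T(t)$ is monotone and continuous from below, i.e. $u_n\nearrow u$ in $\mathrm{UC}_\kappa$ implies $T(t)u_n\nearrow T(t)u$. Standing assumptions: (A1) for every $\lambda\in\Lambda$, $S_\lambda=(S_\lambda(t))_{t\ge0}$ is a Feller semigroup of linear operators with $S_\lambda(t)1=1$ for all $t\geq 0$; (A2) there are $\alpha,\beta\in\mathbb{R}$ with $\|S_\lambda(t)u\|_\kappa\le e^{\alpha t}\|u\|_\kappa$ and $\|S_\lambda(t)u\|_{\mathrm{Lip}}\le e^{\beta t}\|u\|_{\mathrm{Lip}}$ for all $u\in\mathrm{Lip}_{\rm b}$, $\lambda\in\Lambda$, $t\ge0$. For $h\ge0$, $u\in\mathrm{UC}_\kappa$: $(\mathcal{E}_hu)(x)=\sup_{\lambda\in\Lambda}(S_\lambda(h)u)(x)$; $\mathcal{E}_h$ maps $\mathrm{UC}_\kappa$ to itself. $P$ is the set of finite subsets $\pi\subset[0,\infty)$ with $0\in\pi$, and $P_t=\{\pi\in P:\max\pi=t\}$. For $\pi=\{t_0,\dots,t_m\}$ with $0=t_0<t_1<\dots<t_m$, $m\ge 1$, $\mathcal{E}_\pi u=\mathcal{E}_{t_1-t_0}\cdots\mathcal{E}_{t_m-t_{m-1}}u$ (composition), and $\mathcal{E}_{\{0\}}u=u$.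 The semigroup envelope is $(\mathscr{S}(t)u)(x)=\sup_{\pi\in P_t}(\mathcal{E}_\pi u)(x)$ for $t\ge0$, $u\in\mathrm{UC}_\kappa$, $x\in M$. Space-time discrete controls: under the assumption of the claim, $(S_\lambda(t)v)(x):=\mathbb{E}[v(X_t^{\lambda,x})]$ is also used for Borel measurable $v\colon M\to\mathbb{R}$ with $|v|\le w$ for some $w\in\mathrm{UC}_\kappa$. Let $$\Lambda_M:=\Big\{(\lambda_i,B_i)_{i\in\mathbb{N}}\in(\Lambda\times\mathcal{B})^{\mathbb{N}}\,\Big|\,B_i\cap B_j=\emptyset\text{ for }i\ne j,\ \bigcup_{i\in\mathbb{N}}B_i=M\Big\},$$ and for $\lambda=(\lambda_i,B_i)_{i\in\mathbb{N}}\in\Lambda_M$ put $(S_\lambda(t)v)(x):=\sum_{i\in\mathbb{N}}1_{B_i}(x)\,(S_{\lambda_i}(t)v)(x)$, $x\in M$. For $t\ge0$ let $$\Lambda_{\rm ad}^t:=\Big\{(\lambda_k,h_k)_{k=1,\dots,m}\in(\Lambda_M\times[0,t])^m\,\Big|\,m\in\mathbb{N},\ \sum_{k=1}^mh_k=t\Big\},$$ and for $\lambda=(\lambda_k,h_k)_{k=1,\dots,m}\in\Lambda_{\rm ad}^t$ and $u\in\mathrm{UC}_\kappa$ let $J_\lambda u:=S_{\lambda_1}(h_1)\cdots S_{\lambda_m}(h_m)u$ (successive application; all intermediate functions are Borel measurable and dominated in absolute value by elements of $\mathrm{UC}_\kappa$). *)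

theory Defs
  imports "HOL-Probability.Probability"
begin

text \<open>
  The metric space \<open>M\<close> is the type \<open>'m\<close>.  Norms take values in \<open>[0,\<infinity>]\<close>, so that finiteness of a norm
  is a statement; in particular the Lipschitz seminorm of a function that is not Lipschitz is
  \<open>\<infinity>\<close> (infimum of the empty set).
\<close>

definition sup_norm :: "('m \<Rightarrow> real) \<Rightarrow> ennreal" where
  "sup_norm u = (SUP x. ennreal \<bar>u x\<bar>)"

definition wnorm :: "('m \<Rightarrow> real) \<Rightarrow> ('m \<Rightarrow> real) \<Rightarrow> ennreal" where
  "wnorm \<kappa> u = sup_norm (\<lambda>x. \<kappa> x * u x)"

definition lip_norm :: "('m::metric_space \<Rightarrow> real) \<Rightarrow> ennreal" where
  "lip_norm u = Inf {ennreal L |L. L-lipschitz_on UNIV u}"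

definition C_space :: "('m::metric_space \<Rightarrow> real) \<Rightarrow> ('m \<Rightarrow> real) set" where
  "C_space \<kappa> = {u. continuous_on UNIV u \<and> wnorm \<kappa> u < \<infinity>}"

definition Lip_b :: "('m::metric_space \<Rightarrow> real) set" where
  "Lip_b = {u. bounded (range u) \<and> (\<exists>L. L-lipschitz_on UNIV u)}"

definition UC :: "('m::metric_space \<Rightarrow> real) \<Rightarrow> ('m \<Rightarrow> real) set" where
  "UC \<kappa> = {u \<in> C_space \<kappa>. \<forall>\<epsilon>>0. \<exists>v\<in>Lip_b. wnorm \<kappa> (\<lambda>x. u x - v x) < ennreal \<epsilon>}"

definition increases_to :: "(nat \<Rightarrow> 'm \<Rightarrow> real) \<Rightarrow> ('m \<Rightarrow> real) \<Rightarrow> bool" where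
  "increases_to us u \<longleftrightarrow> (\<forall>n x. us n x \<le> us (Suc n) x) \<and> (\<forall>x. (\<lambda>n. us n x) \<longlonglongrightarrow> u x)"

text \<open>
  Operators are total functions on \<open>'m \<Rightarrow> real\<close>; only their values at times \<open>t \<ge> 0\<close> and on
  \<open>UC \<kappa>\<close> are constrained or used.
\<close>

definition UC_continuous ::
  "('m::metric_space \<Rightarrow> real) \<Rightarrow> (('m \<Rightarrow> real) \<Rightarrow> 'm \<Rightarrow> real) \<Rightarrow> bool" where
  "UC_continuous \<kappa> F \<longleftrightarrow>
     (\<forall>u\<in>UC \<kappa>. \<forall>\<epsilon>>0. \<exists>\<delta>>0. \<forall>v\<in>UC \<kappa>.
        wnorm \<kappa> (\<lambda>x. v x - u x) < ennreal \<delta> \<longrightarrow> wnorm \<kappa> (\<lambda>x. F v x - F u x) < ennreal \<epsilon>)"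

definition feller_semigroup ::
  "('m::metric_space \<Rightarrow> real) \<Rightarrow> (real \<Rightarrow> ('m \<Rightarrow> real) \<Rightarrow> 'm \<Rightarrow> real) \<Rightarrow> bool" where
  "feller_semigroup \<kappa> T \<longleftrightarrow>
     (\<forall>t\<ge>0. (\<forall>u\<in>UC \<kappa>. T t u \<in> UC \<kappa>) \<and> UC_continuous \<kappa> (T t)) \<and>
     (\<forall>u\<in>UC \<kappa>. T 0 u = u) \<and>
     (\<forall>s\<ge>0. \<forall>t\<ge>0. \<forall>u\<in>UC \<kappa>. T (s + t) u = T s (T t u)) \<and>
     (\<forall>t\<ge>0. \<forall>u\<in>UC \<kappa>. \<forall>v\<in>UC \<kappa>. (\<forall>x. u x \<le> v x) \<longrightarrow> (\<forall>x. T t u x \<le> T t v x)) \<and>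
     (\<forall>t\<ge>0. \<forall>us u. (\<forall>n. us n \<in> UC \<kappa>) \<longrightarrow> u \<in> UC \<kappa> \<longrightarrow> increases_to us u \<longrightarrow>
        increases_to (\<lambda>n. T t (us n)) (T t u))"

definition UC_linear ::
  "('m::metric_space \<Rightarrow> real) \<Rightarrow> (('m \<Rightarrow> real) \<Rightarrow> 'm \<Rightarrow> real) \<Rightarrow> bool" where
  "UC_linear \<kappa> F \<longleftrightarrow>
     (\<forall>u\<in>UC \<kappa>. \<forall>v\<in>UC \<kappa>. F (\<lambda>x. u x + v x) = (\<lambda>x. F u x + F v x)) \<and>
     (\<forall>c. \<forall>u\<in>UC \<kappa>. F (\<lambda>x. c * u x) = (\<lambda>x. c * F u x))"

definition sup_op ::
  "'l set \<Rightarrow> ('l \<Rightarrow> real \<Rightarrow> ('m \<Rightarrow> real) \<Rightarrow> 'm \<Rightarrow> real) \<Rightarrow> real \<Rightarrow> ('m \<Rightarrow> real) \<Rightarrow> 'm \<Rightarrow> real" where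
  "sup_op \<Lambda> S h u x = (SUP l\<in>\<Lambda>. S l h u x)"

definition partitions :: "real set set" where
  "partitions = {\<pi>. finite \<pi> \<and> \<pi> \<subseteq> {0..} \<and> 0 \<in> \<pi>}"

definition partitions_upto :: "real \<Rightarrow> real set set" where
  "partitions_upto t = {\<pi> \<in> partitions. Max \<pi> = t}"

fun grid_op ::
  "'l set \<Rightarrow> ('l \<Rightarrow> real \<Rightarrow> ('m \<Rightarrow> real) \<Rightarrow> 'm \<Rightarrow> real) \<Rightarrow> real list \<Rightarrow> ('m \<Rightarrow> real) \<Rightarrow> 'm \<Rightarrow> real" where
  "grid_op \<Lambda> S (s # t # ts) u = sup_op \<Lambda> S (t - s) (grid_op \<Lambda> S (t # ts) u)"
| "grid_op \<Lambda> S [t] u = u"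
| "grid_op \<Lambda> S [] u = u"

definition partition_op ::
  "'l set \<Rightarrow> ('l \<Rightarrow> real \<Rightarrow> ('m \<Rightarrow> real) \<Rightarrow> 'm \<Rightarrow> real) \<Rightarrow> real set \<Rightarrow> ('m \<Rightarrow> real) \<Rightarrow> 'm \<Rightarrow> real" where
  "partition_op \<Lambda> S \<pi> u = grid_op \<Lambda> S (sorted_list_of_set \<pi>) u"

definition semigroup_envelope ::
  "'l set \<Rightarrow> ('l \<Rightarrow> real \<Rightarrow> ('m \<Rightarrow> real) \<Rightarrow> 'm \<Rightarrow> real) \<Rightarrow> real \<Rightarrow> ('m \<Rightarrow> real) \<Rightarrow> 'm \<Rightarrow> real" where
  "semigroup_envelope \<Lambda> S t u x = (SUP \<pi>\<in>partitions_upto t. partition_op \<Lambda> S \<pi> u x)"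

text \<open>
  The random variable \<open>X l t x\<close> lives on its own probability space \<open>P l t x\<close>; a common space for
  all of them, or for all times of a process, is the special case of a constant \<open>P\<close>.
\<close>

definition represented_by ::
  "('m::metric_space \<Rightarrow> real) \<Rightarrow> 'l set \<Rightarrow> ('l \<Rightarrow> real \<Rightarrow> ('m \<Rightarrow> real) \<Rightarrow> 'm \<Rightarrow> real) \<Rightarrow>
   ('l \<Rightarrow> real \<Rightarrow> 'm \<Rightarrow> 'w measure) \<Rightarrow> ('l \<Rightarrow> real \<Rightarrow> 'm \<Rightarrow> 'w \<Rightarrow> 'm) \<Rightarrow> bool" where
  "represented_by \<kappa> \<Lambda> S P X \<longleftrightarrow>
     (\<forall>l\<in>\<Lambda>. \<forall>t\<ge>0. \<forall>x.
        prob_space (P l t x) \<and> X l t x \<in> measurable (P l t x) borel \<and>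
        (\<forall>u\<in>UC \<kappa>. integrable (P l t x) (\<lambda>\<omega>. u (X l t x \<omega>)) \<and>
           S l t u x = prob_space.expectation (P l t x) (\<lambda>\<omega>. u (X l t x \<omega>))))"

text \<open>The extension of the linear semigroups to Borel measurable functions.\<close>

definition kernel_op ::
  "('l \<Rightarrow> real \<Rightarrow> 'm \<Rightarrow> 'w measure) \<Rightarrow> ('l \<Rightarrow> real \<Rightarrow> 'm \<Rightarrow> 'w \<Rightarrow> 'm) \<Rightarrow>
   'l \<Rightarrow> real \<Rightarrow> ('m \<Rightarrow> real) \<Rightarrow> 'm \<Rightarrow> real" where
  "kernel_op P X l t v x = prob_space.expectation (P l t x) (\<lambda>\<omega>. v (X l t x \<omega>))"

definition space_controls :: "'l set \<Rightarrow> (nat \<Rightarrow> 'l \<times> 'm::metric_space set) set" where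
  "space_controls \<Lambda> =
     {c. (\<forall>i. c i \<in> \<Lambda> \<times> sets borel) \<and>
         (\<forall>i j. i \<noteq> j \<longrightarrow> snd (c i) \<inter> snd (c j) = {}) \<and>
         (\<Union>i. snd (c i)) = UNIV}"

definition control_op ::
  "('l \<Rightarrow> real \<Rightarrow> 'm \<Rightarrow> 'w measure) \<Rightarrow> ('l \<Rightarrow> real \<Rightarrow> 'm \<Rightarrow> 'w \<Rightarrow> 'm) \<Rightarrow>
   (nat \<Rightarrow> 'l \<times> 'm set) \<Rightarrow> real \<Rightarrow> ('m \<Rightarrow> real) \<Rightarrow> 'm \<Rightarrow> real" where
  "control_op P X c t v x =
     (\<Sum>i. indicator (snd (c i)) x * kernel_op P X (fst (c i)) t v x)"

definition admissible_controls ::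
  "'l set \<Rightarrow> real \<Rightarrow> ((nat \<Rightarrow> 'l \<times> 'm::metric_space set) \<times> real) list set" where
  "admissible_controls \<Lambda> t =
     {cs. cs \<noteq> [] \<and> set cs \<subseteq> space_controls \<Lambda> \<times> {0..t} \<and> sum_list (map snd cs) = t}"

fun J_op ::
  "('l \<Rightarrow> real \<Rightarrow> 'm \<Rightarrow> 'w measure) \<Rightarrow> ('l \<Rightarrow> real \<Rightarrow> 'm \<Rightarrow> 'w \<Rightarrow> 'm) \<Rightarrow>
   ((nat \<Rightarrow> 'l \<times> 'm set) \<times> real) list \<Rightarrow> ('m \<Rightarrow> real) \<Rightarrow> 'm \<Rightarrow> real" where
  "J_op P X [] u = u"
| "J_op P X ((c, h) # cs) u = control_op P X c h (J_op P X cs u)"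

end

theory Submission
  imports Defs
begin

text \<open>
  Allowing a controller to choose the dynamics depending on the current position gains nothing over
  taking the supremum over constant controls on each time interval, provided that the time grid may
  be refined.

  Upper bound for controls: on each piece of the state space a space-dependent control acts as one
  of the kernels, so for a Borel function \<open>v\<close> lying below \<open>w \<in> UC \<kappa>\<close> one control step satisfies
  \<open>control_op P X c h v \<le> sup_op \<Lambda> S h w\<close>.  Iterating, a control with step sizes \<open>h\<^sub>1, \<dots>, h\<^sub>m\<close> is
  dominated by \<open>sup_op \<Lambda> S h\<^sub>1 \<dots> sup_op \<Lambda> S h\<^sub>m u\<close> (\<open>J_op_le_iterate\<close>), and this is the partition
  operator of the partial sums of the step sizes.

  Approximation by controls: for \<open>w \<in> UC \<kappa>\<close> the functions \<open>S l h w\<close> and \<open>sup_op \<Lambda> S h w\<close> are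
  continuous, so the sets on which \<open>l\<close> is within \<open>e\<close> of optimal form an open cover of the space.  A
  separable metric space is Lindelof; making a countable subcover disjoint yields a space-dependent
  control that is within \<open>e\<close> of the supremum everywhere (\<open>nearly_optimal_control\<close>).  Kernels
  integrate constants to themselves, so the errors of the steps simply add up
  (\<open>iterate_approximated\<close>).

  For this to make sense, \<open>sup_op\<close> has to preserve \<open>UC \<kappa>\<close>: it preserves bounded Lipschitz functions
  since the growth estimates are uniform in the control, and it is Lipschitz for the weighted norm,
  uniformly in the control, so the property passes to the closure (\<open>sup_op_UC\<close>).  Moreover the
  intermediate functions of a control, which are only Borel, have to be integrable and measurable
  again after a step: this follows since the kernels depend measurably on the starting point
  (\<open>kernel_measurable\<close>) and \<open>UC \<kappa>\<close> supplies dominating functions.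
\<close>

section \<open>Suprema of reals and separable metric spaces\<close>

lemma cSUP_diff_le:
  fixes f g :: "'i \<Rightarrow> real"
  assumes "I \<noteq> {}" "bdd_above (f ` I)" "bdd_above (g ` I)" "\<And>i. i \<in> I \<Longrightarrow> \<bar>f i - g i\<bar> \<le> e"
  shows "\<bar>(SUP i\<in>I. f i) - (SUP i\<in>I. g i)\<bar> \<le> e"
proof -
  have "(SUP i\<in>I. f i) \<le> (SUP i\<in>I. g i) + e"
    using assms(1) by (rule cSUP_least) (smt (verit) assms cSUP_upper)
  moreover have "(SUP i\<in>I. g i) \<le> (SUP i\<in>I. f i) + e"
    using assms(1) by (rule cSUP_least) (smt (verit) assms cSUP_upper)
  ultimately show ?thesis by linarith
qed

text \<open>
  The supremum of a set of reals is defined as its least upper bound, so it is determined by the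
  collection of upper bounds, and the two sets have the same upper bounds.  Stated in this way, the
  comparison applies to unbounded sets as well.
\<close>

lemma Sup_eq_Sup_if_mutually_approximating:
  fixes A B :: "real set"
  assumes "\<And>b. b \<in> B \<Longrightarrow> \<exists>a\<in>A. b \<le> a"
    and "\<And>a e. a \<in> A \<Longrightarrow> e > 0 \<Longrightarrow> \<exists>b\<in>B. a - e \<le> b"
  shows "Sup A = Sup B"
proof -
  have "(\<forall>a\<in>A. a \<le> z) \<longleftrightarrow> (\<forall>b\<in>B. b \<le> z)" for z
  proof
    assume "\<forall>a\<in>A. a \<le> z"
    then show "\<forall>b\<in>B. b \<le> z" using assms(1) by force
  next
    assume *: "\<forall>b\<in>B. b \<le> z"
    show "\<forall>a\<in>A. a \<le> z"
    proof
      fix a assume a: "a \<in> A"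
      show "a \<le> z"
      proof (rule field_le_epsilon)
        fix e :: real assume "e > 0"
        from assms(2)[OF a this] * show "a \<le> z + e" by force
      qed
    qed
  qed
  then show ?thesis unfolding Sup_real_def by simp
qed

text \<open>
  Balls of radius \<open>1 / (n + 1)\<close> around the points of a countable dense set form a countable base.
\<close>

lemma separable_metric_imp_Lindelof:
  assumes separable: "separable_space (euclidean :: 'm::metric_space topology)"
  shows "Lindelof_space (euclidean :: 'm topology)"
proof (rule second_countable_imp_Lindelof_space)
  obtain D :: "'m set" where D: "countable D" "closure D = UNIV"
    using separable by (auto simp: separable_space_def)
  define B where "B = (\<lambda>(a, n). ball a (inverse (real (Suc n)))) ` (D \<times> UNIV)"
  have "\<exists>V\<in>B. x \<in> V \<and> V \<subseteq> U" if U: "open U" "x \<in> U" for U and x :: 'm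
  proof -
    obtain e where e: "e > 0" "ball x e \<subseteq> U" using U by (auto elim: openE)
    obtain n where n: "inverse (real (Suc n)) < e / 2" using reals_Archimedean[of "e / 2"] e by auto
    have "x \<in> closure D" using D by simp
    then obtain a where a: "a \<in> D" "dist a x < inverse (real (Suc n))"
      unfolding closure_approachable by (meson inverse_positive_iff_positive of_nat_0_less_iff zero_less_Suc)
    have "ball a (inverse (real (Suc n))) \<subseteq> ball x e"
    proof
      fix y assume "y \<in> ball a (inverse (real (Suc n)))"
      then show "y \<in> ball x e"
        using a n dist_triangle[of x y a] by (simp add: dist_commute)
    qed
    then show ?thesis using a e unfolding B_def
      by (intro bexI[of _ "ball a (inverse (real (Suc n)))"]) (auto simp: dist_commute)
  qed
  moreover have "countable B" using D(1) by (simp add: B_def)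
  ultimately show "second_countable (euclidean :: 'm topology)"
    unfolding second_countable_def by (intro exI[of _ B]) (auto simp: B_def)
qed

section \<open>The function spaces\<close>

lemma Lip_b_continuous: "v \<in> Lip_b \<Longrightarrow> continuous_on UNIV v"
  by (auto simp: Lip_b_def intro: lipschitz_on_continuous_on)

lemma Lip_b_diff:
  assumes "u \<in> Lip_b" "v \<in> Lip_b"
  shows "(\<lambda>x. u x - v x) \<in> Lip_b"
  using assms unfolding Lip_b_def
  by (auto intro: bounded_minus_comp lipschitz_on_diff)

lemma Lip_b_abs:
  assumes "u \<in> Lip_b"
  shows "(\<lambda>x. \<bar>u x\<bar>) \<in> Lip_b"
proof -
  from assms obtain L where L: "L-lipschitz_on UNIV u" by (auto simp: Lip_b_def)
  have "L-lipschitz_on UNIV (\<lambda>x. \<bar>u x\<bar>)"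
  proof (rule lipschitz_onI)
    fix x y
    show "dist \<bar>u x\<bar> \<bar>u y\<bar> \<le> L * dist x y"
      using lipschitz_onD[OF L, of x y] by (auto simp: dist_real_def)
  qed (rule lipschitz_on_nonneg[OF L])
  then show ?thesis using assms by (auto simp: Lip_b_def bounded_iff)
qed

text \<open>
  The content of the left-to-right direction is that the infimum defining \<open>lip_norm\<close> is attained:
  the bounds with constant \<open>L + r\<close> are combined with \<open>r \<rightarrow> 0\<close> at a fixed pair of points.
\<close>

lemma lip_norm_le_iff:
  assumes "0 \<le> L"
  shows "lip_norm f \<le> ennreal L \<longleftrightarrow> L-lipschitz_on UNIV f"
proof
  assume "L-lipschitz_on UNIV f"
  then show "lip_norm f \<le> ennreal L" unfolding lip_norm_def by (intro Inf_lower) auto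
next
  assume le: "lip_norm f \<le> ennreal L"
  show "L-lipschitz_on UNIV f"
  proof (rule lipschitz_onI[OF _ assms])
    fix x y
    show "dist (f x) (f y) \<le> L * dist x y"
    proof (rule field_le_epsilon)
      fix e :: real assume "e > 0"
      \<comment> \<open>The summand \<open>1\<close> keeps the denominator positive when \<open>x = y\<close>.\<close>
      define r where "r = e / (dist x y + 1)"
      have r: "r > 0" using \<open>e > 0\<close> by (simp add: r_def add_nonneg_pos)
      then have "lip_norm f < ennreal (L + r)"
        using le assms by (simp add: ennreal_lessI le_less_trans)
      then obtain K where K: "K-lipschitz_on UNIV f" "ennreal K < ennreal (L + r)"
        unfolding lip_norm_def Inf_less_iff by auto
      have "K < L + r" using K by (simp add: ennreal_less_iff lipschitz_on_nonneg)
      have "dist (f x) (f y) \<le> K * dist x y" using K(1) by (rule lipschitz_onD) auto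
      also have "\<dots> \<le> (L + r) * dist x y" using \<open>K < L + r\<close> by (intro mult_right_mono) auto
      also have "r * dist x y \<le> e"
        using \<open>e > 0\<close> by (simp add: r_def divide_simps add_nonneg_pos)
      then have "(L + r) * dist x y \<le> L * dist x y + e" by (simp add: algebra_simps)
      finally show "dist (f x) (f y) \<le> L * dist x y + e" .
    qed
  qed
qed

lemma wnorm_le_iff:
  assumes "\<And>x. 0 < \<kappa> x" "0 \<le> c"
  shows "wnorm \<kappa> u \<le> ennreal c \<longleftrightarrow> (\<forall>x. \<kappa> x * \<bar>u x\<bar> \<le> c)"
  using assms by (simp add: wnorm_def sup_norm_def SUP_le_iff abs_mult less_imp_le)

text \<open>
  Membership in \<open>C_space \<kappa>\<close> comes for free from weighted uniform approximation by bounded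
  Lipschitz functions: \<open>\<kappa> * u\<close> is a uniform limit of bounded continuous functions, and dividing by
  the positive continuous weight preserves continuity.
\<close>

lemma UC_iff:
  fixes \<kappa> :: "'m::metric_space \<Rightarrow> real"
  assumes cont: "continuous_on UNIV \<kappa>" and bdd: "bounded (range \<kappa>)" and pos: "\<And>x. 0 < \<kappa> x"
  shows "u \<in> UC \<kappa> \<longleftrightarrow> (\<forall>\<epsilon>>0. \<exists>v\<in>Lip_b. \<forall>x. \<kappa> x * \<bar>u x - v x\<bar> \<le> \<epsilon>)"
proof
  assume "u \<in> UC \<kappa>"
  show "\<forall>\<epsilon>>0. \<exists>v\<in>Lip_b. \<forall>x. \<kappa> x * \<bar>u x - v x\<bar> \<le> \<epsilon>"
  proof (intro allI impI)
    fix e :: real assume "e > 0"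
    with \<open>u \<in> UC \<kappa>\<close> obtain v where "v \<in> Lip_b" "wnorm \<kappa> (\<lambda>x. u x - v x) < ennreal e"
      by (auto simp: UC_def)
    then show "\<exists>v\<in>Lip_b. \<forall>x. \<kappa> x * \<bar>u x - v x\<bar> \<le> e"
      using wnorm_le_iff[of \<kappa> e "\<lambda>x. u x - v x", OF pos] \<open>e > 0\<close> by (auto intro!: bexI[of _ v])
  qed
next
  assume appr: "\<forall>\<epsilon>>0. \<exists>v\<in>Lip_b. \<forall>x. \<kappa> x * \<bar>u x - v x\<bar> \<le> \<epsilon>"
  have "\<forall>n. \<exists>v\<in>Lip_b. \<forall>x. \<kappa> x * \<bar>u x - v x\<bar> \<le> inverse (real (Suc n))"
    using appr by simp
  then obtain v where v: "\<And>n. v n \<in> Lip_b"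
    "\<And>n x. \<kappa> x * \<bar>u x - v n x\<bar> \<le> inverse (real (Suc n))" by metis
  have "continuous_on UNIV (\<lambda>x. \<kappa> x * u x)"
  proof (rule uniform_limit_theorem[where F=sequentially])
    show "\<forall>\<^sub>F n in sequentially. continuous_on UNIV (\<lambda>x. \<kappa> x * v n x)"
      by (intro always_eventually allI continuous_intros cont Lip_b_continuous v(1))
    show "uniform_limit UNIV (\<lambda>n x. \<kappa> x * v n x) (\<lambda>x. \<kappa> x * u x) sequentially"
    proof (rule uniform_limitI)
      fix e :: real assume "e > 0"
      have "\<forall>\<^sub>F n in sequentially. inverse (real (Suc n)) < e"
        using \<open>e > 0\<close> LIMSEQ_inverse_real_of_nat by (rule order_tendstoD(2)[rotated])
      then show "\<forall>\<^sub>F n in sequentially. \<forall>x\<in>UNIV. dist (\<kappa> x * v n x) (\<kappa> x * u x) < e"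
      proof eventually_elim
        case (elim n)
        have "dist (\<kappa> x * v n x) (\<kappa> x * u x) = \<kappa> x * \<bar>u x - v n x\<bar>" for x
          using pos[of x] by (simp add: dist_real_def abs_mult flip: right_diff_distrib)
        then show ?case using v(2) elim by (metis le_less_trans)
      qed
    qed
  qed simp
  then have "continuous_on UNIV (\<lambda>x. (\<kappa> x * u x) / \<kappa> x)"
    using cont by (rule continuous_on_divide) (use pos in \<open>auto simp: less_imp_neq[symmetric]\<close>)
  also have "(\<lambda>x. (\<kappa> x * u x) / \<kappa> x) = u"
    using pos by (auto simp: fun_eq_iff less_imp_neq[symmetric])
  finally have cont_u: "continuous_on UNIV u" .
  obtain v where v: "v \<in> Lip_b" "\<And>x. \<kappa> x * \<bar>u x - v x\<bar> \<le> 1" using appr zero_less_one by blast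
  obtain K where K: "\<And>x. \<bar>\<kappa> x\<bar> \<le> K" using bdd by (auto simp: bounded_iff)
  obtain B where B: "\<And>x. \<bar>v x\<bar> \<le> B" using v(1) by (auto simp: Lip_b_def bounded_iff)
  have nonneg: "0 \<le> K" "0 \<le> B" using K B by (meson abs_ge_zero order_trans)+
  have "\<kappa> x * \<bar>u x\<bar> \<le> 1 + K * B" for x
  proof -
    have "\<kappa> x * \<bar>u x\<bar> \<le> \<kappa> x * \<bar>u x - v x\<bar> + \<kappa> x * \<bar>v x\<bar>"
      using pos[of x] by (simp flip: distrib_left) 
    also have "\<kappa> x * \<bar>v x\<bar> \<le> K * B"
      using K[of x] B[of x] nonneg by (intro mult_mono) auto
    finally show ?thesis using v(2)[of x] by simp
  qed
  then have "wnorm \<kappa> u \<le> ennreal (1 + K * B)"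
    using pos nonneg by (subst wnorm_le_iff) auto
  then have "u \<in> C_space \<kappa>" using cont_u by (auto simp: C_space_def less_top[symmetric] top_unique)
  moreover have "\<exists>v\<in>Lip_b. wnorm \<kappa> (\<lambda>x. u x - v x) < ennreal e" if e: "e > 0" for e
  proof -
    obtain v where v: "v \<in> Lip_b" "\<And>x. \<kappa> x * \<bar>u x - v x\<bar> \<le> e / 2"
      using appr half_gt_zero[OF e] by blast
    have "wnorm \<kappa> (\<lambda>x. u x - v x) \<le> ennreal (e / 2)"
      using v(2) pos e by (subst wnorm_le_iff) auto
    also have "\<dots> < ennreal e" using e by (simp add: ennreal_lessI)
    finally show ?thesis using v(1) by blast
  qed
  ultimately show "u \<in> UC \<kappa>" by (auto simp: UC_def)
qed

section \<open>Transition kernels\<close>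

locale linear_feller_family =
  fixes \<kappa> :: "'m::metric_space \<Rightarrow> real"
    and \<Lambda> :: "'l set"
    and S :: "'l \<Rightarrow> real \<Rightarrow> ('m \<Rightarrow> real) \<Rightarrow> 'm \<Rightarrow> real"
    and \<alpha> \<beta> :: real
    and P :: "'l \<Rightarrow> real \<Rightarrow> 'm \<Rightarrow> 'w measure"
    and X :: "'l \<Rightarrow> real \<Rightarrow> 'm \<Rightarrow> 'w \<Rightarrow> 'm"
  assumes separable: "separable_space (euclidean :: 'm topology)"
    and controls_nonempty: "\<Lambda> \<noteq> {}"
    and weight_cont: "continuous_on UNIV \<kappa>" and weight_bdd: "bounded (range \<kappa>)"
    and weight_pos: "0 < \<kappa> x"
    and feller: "l \<in> \<Lambda> \<Longrightarrow> feller_semigroup \<kappa> (S l)"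
    and weighted_growth:
      "l \<in> \<Lambda> \<Longrightarrow> t \<ge> 0 \<Longrightarrow> u \<in> Lip_b \<Longrightarrow> wnorm \<kappa> (S l t u) \<le> ennreal (exp (\<alpha> * t)) * wnorm \<kappa> u"
    and lipschitz_growth:
      "l \<in> \<Lambda> \<Longrightarrow> t \<ge> 0 \<Longrightarrow> u \<in> Lip_b \<Longrightarrow> lip_norm (S l t u) \<le> ennreal (exp (\<beta> * t)) * lip_norm u"
    and represented: "represented_by \<kappa> \<Lambda> S P X"
begin

lemmas UC_iff = UC_iff[OF weight_cont weight_bdd weight_pos]

lemma Lip_b_UC: "u \<in> Lip_b \<Longrightarrow> u \<in> UC \<kappa>"
  unfolding UC_iff by (force intro!: bexI[of _ u])

lemma UC_abs: "u \<in> UC \<kappa> \<Longrightarrow> (\<lambda>x. \<bar>u x\<bar>) \<in> UC \<kappa>"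
  unfolding UC_iff
proof (intro allI impI)
  fix e :: real assume "\<forall>e>0. \<exists>v\<in>Lip_b. \<forall>x. \<kappa> x * \<bar>u x - v x\<bar> \<le> e" "e > 0"
  then obtain v where v: "v \<in> Lip_b" "\<And>x. \<kappa> x * \<bar>u x - v x\<bar> \<le> e" by blast
  have "\<kappa> x * \<bar>\<bar>u x\<bar> - \<bar>v x\<bar>\<bar> \<le> e" for x
    using mult_left_mono[OF abs_triangle_ineq3[of "u x" "v x"], of "\<kappa> x"] weight_pos[of x] v(2)[of x]
    by linarith
  then show "\<exists>v\<in>Lip_b. \<forall>x. \<kappa> x * \<bar>\<bar>u x\<bar> - v x\<bar> \<le> e" using Lip_b_abs[OF v(1)] by (intro bexI) auto
qed

lemma UC_continuous: "u \<in> UC \<kappa> \<Longrightarrow> continuous_on UNIV u"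
  by (simp add: UC_def C_space_def)

lemma UC_measurable: "u \<in> UC \<kappa> \<Longrightarrow> u \<in> borel_measurable borel"
  by (intro borel_measurable_continuous_onI UC_continuous)

lemma S_UC: "l \<in> \<Lambda> \<Longrightarrow> t \<ge> 0 \<Longrightarrow> u \<in> UC \<kappa> \<Longrightarrow> S l t u \<in> UC \<kappa>"
  using feller[of l] unfolding feller_semigroup_def by blast

lemma S_0: "l \<in> \<Lambda> \<Longrightarrow> u \<in> UC \<kappa> \<Longrightarrow> S l 0 u = u"
  using feller[of l] unfolding feller_semigroup_def by blast

definition kernel :: "'l \<Rightarrow> real \<Rightarrow> 'm \<Rightarrow> 'm measure" where
  "kernel l t x = distr (P l t x) borel (X l t x)"

lemma sets_kernel [simp, measurable_cong]: "sets (kernel l t x) = sets borel"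
  by (simp add: kernel_def)

lemma space_kernel [simp]: "space (kernel l t x) = UNIV"
  by (simp add: kernel_def)

context
  fixes l t assumes l: "l \<in> \<Lambda>" and t: "t \<ge> (0 :: real)"
begin

lemma X_measurable: "X l t x \<in> measurable (P l t x) borel"
  using represented l t by (simp add: represented_by_def)

lemma prob_space_kernel: "prob_space (kernel l t x)"
  unfolding kernel_def using represented l t
  by (intro prob_space.prob_space_distr) (auto simp: represented_by_def)

lemma kernel_op_eq:
  assumes "v \<in> borel_measurable borel"
  shows "kernel_op P X l t v x = (\<integral>y. v y \<partial>kernel l t x)"
  unfolding kernel_op_def kernel_def using assms X_measurable by (simp add: integral_distr)

lemma integrable_UC: "u \<in> UC \<kappa> \<Longrightarrow> integrable (kernel l t x) u"
  unfolding kernel_def using represented l t X_measurable UC_measurable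
  by (subst integrable_distr_eq) (auto simp: represented_by_def)

lemma S_eq_kernel_op: "u \<in> UC \<kappa> \<Longrightarrow> S l t u x = kernel_op P X l t u x"
  using represented l t by (auto simp: represented_by_def kernel_op_def)

lemma S_eq_integral: "u \<in> UC \<kappa> \<Longrightarrow> S l t u x = (\<integral>y. u y \<partial>kernel l t x)"
  by (simp add: S_eq_kernel_op kernel_op_eq UC_measurable)

lemma S_diff:
  assumes "u \<in> UC \<kappa>" "v \<in> UC \<kappa>" "(\<lambda>x. u x - v x) \<in> UC \<kappa>"
  shows "S l t (\<lambda>x. u x - v x) x = S l t u x - S l t v x"
  using assms by (simp add: S_eq_integral integrable_UC)

lemma S_bounded:
  assumes "u \<in> UC \<kappa>" "\<And>x. \<bar>u x\<bar> \<le> B"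
  shows "\<bar>S l t u x\<bar> \<le> B"
proof -
  interpret prob_space "kernel l t x" by (rule prob_space_kernel)
  have "\<bar>\<integral>y. u y \<partial>kernel l t x\<bar> \<le> (\<integral>y. \<bar>u y\<bar> \<partial>kernel l t x)" by (rule integral_abs_bound)
  also have "\<dots> \<le> (\<integral>y. B \<partial>kernel l t x)"
    using assms integrable_UC[OF assms(1)] by (intro integral_mono) auto
  finally show ?thesis using assms(1) prob_space by (simp add: S_eq_integral)
qed

lemma S_lipschitz:
  assumes u: "u \<in> Lip_b" "L-lipschitz_on UNIV u"
  shows "(exp (\<beta> * t) * L)-lipschitz_on UNIV (S l t u)"
proof -
  have L: "0 \<le> L" using u(2) by (rule lipschitz_on_nonneg)
  have "lip_norm (S l t u) \<le> ennreal (exp (\<beta> * t)) * lip_norm u"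
    using l t u(1) by (rule lipschitz_growth)
  also have "\<dots> \<le> ennreal (exp (\<beta> * t)) * ennreal L"
    using u(2) L by (intro mult_left_mono) (auto simp: lip_norm_le_iff)
  also have "\<dots> = ennreal (exp (\<beta> * t) * L)" using L by (simp add: ennreal_mult)
  finally show ?thesis using L by (simp add: lip_norm_le_iff)
qed

text \<open>
  The weighted growth bound is assumed on \<open>Lip_b\<close> only.  It is transferred to \<open>u \<in> UC \<kappa>\<close> by
  replacing \<open>u\<close> with a nearby \<open>w \<in> Lip_b\<close> for which \<open>S l t w\<close> is close to \<open>S l t u\<close>.  How near \<open>w\<close>
  has to be depends on \<open>l\<close>, but the resulting constant does not, and this uniformity is what makes
  the estimate survive the supremum over all controls.
\<close>

lemma S_weighted_diff:
  assumes u: "u \<in> UC \<kappa>" and v: "v \<in> Lip_b" and c: "0 \<le> c" "\<And>x. \<kappa> x * \<bar>u x - v x\<bar> \<le> c"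
  shows "\<kappa> x * \<bar>S l t u x - S l t v x\<bar> \<le> exp (\<alpha> * t) * c"
proof -
  define E where "E = exp (\<alpha> * t)"
  have E: "E > 0" by (simp add: E_def)
  have "\<kappa> x * \<bar>S l t u x - S l t v x\<bar> \<le> E * c + (1 + E) * r" if r: "r > 0" for r
  proof -
    have "UC_continuous \<kappa> (S l t)" using feller[OF l] t by (simp add: feller_semigroup_def)
    then obtain d where d: "d > 0"
      "\<And>w. w \<in> UC \<kappa> \<Longrightarrow> wnorm \<kappa> (\<lambda>x. w x - u x) < ennreal d
          \<Longrightarrow> wnorm \<kappa> (\<lambda>x. S l t w x - S l t u x) < ennreal r"
      unfolding UC_continuous_def using u r by meson
    obtain w where w: "w \<in> Lip_b" "\<And>x. \<kappa> x * \<bar>u x - w x\<bar> \<le> min (d / 2) r"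
      using u[unfolded UC_iff, rule_format, of "min (d / 2) r"] d(1) r by auto
    have "wnorm \<kappa> (\<lambda>x. w x - u x) \<le> ennreal (d / 2)"
      using w(2) d(1) weight_pos by (subst wnorm_le_iff) (auto simp: abs_minus_commute)
    also have "\<dots> < ennreal d" using d(1) by (simp add: ennreal_lessI)
    finally have "wnorm \<kappa> (\<lambda>x. S l t w x - S l t u x) \<le> ennreal r"
      using d(2) w(1) Lip_b_UC by (intro less_imp_le) auto
    then have 1: "\<kappa> x * \<bar>S l t w x - S l t u x\<bar> \<le> r"
      using r weight_pos by (simp add: wnorm_le_iff)
    have "\<kappa> y * \<bar>w y - v y\<bar> \<le> c + r" for y
    proof -
      have "\<kappa> y * \<bar>w y - v y\<bar> \<le> \<kappa> y * (\<bar>u y - v y\<bar> + \<bar>u y - w y\<bar>)"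
        using weight_pos[of y] by (intro mult_left_mono) auto
      then show ?thesis using c(2)[of y] w(2)[of y] by (simp add: algebra_simps)
    qed
    then have "wnorm \<kappa> (\<lambda>x. w x - v x) \<le> ennreal (c + r)"
      using c(1) r weight_pos by (subst wnorm_le_iff) auto
    then have "wnorm \<kappa> (S l t (\<lambda>x. w x - v x)) \<le> ennreal E * ennreal (c + r)"
      using weighted_growth[OF l t Lip_b_diff[OF w(1) v]]
      by (simp add: E_def) (meson mult_left_mono order_trans zero_le)
    then have "wnorm \<kappa> (S l t (\<lambda>x. w x - v x)) \<le> ennreal (E * (c + r))"
      using E c(1) r by (simp add: ennreal_mult)
    then have "\<kappa> x * \<bar>S l t (\<lambda>x. w x - v x) x\<bar> \<le> E * (c + r)"
      using E c(1) r weight_pos by (simp add: wnorm_le_iff)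
    then have 2: "\<kappa> x * \<bar>S l t w x - S l t v x\<bar> \<le> E * (c + r)"
      by (subst (asm) S_diff) (auto intro: Lip_b_UC Lip_b_diff w v)
    have "\<kappa> x * \<bar>S l t u x - S l t v x\<bar>
        \<le> \<kappa> x * (\<bar>S l t w x - S l t u x\<bar> + \<bar>S l t w x - S l t v x\<bar>)"
      using weight_pos[of x] by (intro mult_left_mono) auto
    then show ?thesis using 1 2 by (simp add: algebra_simps)
  qed
  from this[of "e / (1 + E)" for e]
  have le: "\<kappa> x * \<bar>S l t u x - S l t v x\<bar> \<le> E * c + e" if "e > 0" for e
    using that E by simp
  show ?thesis unfolding E_def[symmetric] by (rule field_le_epsilon) (rule le)
qed

text \<open>
  Open sets form an intersection-stable generator of the Borel sets, so only the masses of open sets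
  \<open>U\<close> have to be measurable in the starting point.  The indicator of \<open>U\<close> is the limit of the bounded
  Lipschitz functions \<open>min 1 (n * infdist x (- U))\<close>, whose images under \<open>S l t\<close> are continuous.
\<close>

lemma kernel_measurable: "kernel l t \<in> borel \<rightarrow>\<^sub>M subprob_algebra borel"
proof (rule measurable_subprob_algebra_generated[of borel UNIV "{U. open U}"])
  have prob: "prob_space (kernel l t x)" for x by (rule prob_space_kernel)
  show "Int_stable {U :: 'm set. open U}" by (auto simp: Int_stable_def)
  show "sets borel = sigma_sets UNIV {U :: 'm set. open U}" by (simp add: borel_def)
  show "subprob_space (kernel l t x)" for x
    using prob by (rule prob_space_imp_subprob_space)
  show "(\<lambda>x. emeasure (kernel l t x) UNIV) \<in> borel_measurable borel"
    using prob_space.emeasure_space_1[OF prob] by simp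
  fix U :: "'m set" assume "U \<in> {U. open U}"
  then have U: "open U" by simp
  show "(\<lambda>x. emeasure (kernel l t x) U) \<in> borel_measurable borel"
  \<comment> \<open>The distance to the empty set is \<open>0\<close> by convention, so \<open>U = UNIV\<close> has to be treated apart.\<close>
  proof (cases "U = UNIV")
    case True
    then show ?thesis using prob_space.emeasure_space_1[OF prob] by simp
  next
    case False
    define f where "f n x = min 1 (real n * infdist x (- U))" for n x
    have bound: "\<bar>f n x\<bar> \<le> 1" for n x by (simp add: f_def infdist_nonneg)
    have f: "f n \<in> Lip_b" for n
    proof -
      have "(real n)-lipschitz_on UNIV (f n)"
      proof (rule lipschitz_onI)
        fix x y
        have "dist (f n x) (f n y) \<le> \<bar>real n * infdist x (- U) - real n * infdist y (- U)\<bar>"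
          by (auto simp: f_def dist_real_def)
        also have "\<dots> = real n * \<bar>infdist x (- U) - infdist y (- U)\<bar>"
          by (simp add: abs_mult flip: right_diff_distrib)
        also have "\<dots> \<le> real n * dist x y"
          by (intro mult_left_mono infdist_triangle_abs) auto
        finally show "dist (f n x) (f n y) \<le> real n * dist x y" .
      qed simp
      moreover have "bounded (range (f n))" using bound by (auto simp: bounded_iff)
      ultimately show ?thesis by (auto simp: Lip_b_def)
    qed
    have lim: "(\<lambda>n. f n y) \<longlonglongrightarrow> indicator U y" for y
    proof (cases "y \<in> U")
      case True
      then have pos: "infdist y (- U) > 0"
        using U False by (intro infdist_pos_not_in_closed) auto
      obtain N where N: "1 < real N * infdist y (- U)" using reals_Archimedean3[OF pos] by blast
      have "f n y = 1" if "n \<ge> N" for n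
      proof -
        have "real N * infdist y (- U) \<le> real n * infdist y (- U)"
          using that pos by (intro mult_right_mono) auto
        then show ?thesis using N by (simp add: f_def)
      qed
      then show ?thesis using True
        by (auto intro!: tendsto_eventually eventually_sequentiallyI[of N])
    qed (simp add: f_def)
    have "(\<lambda>n. S l t (f n) x) \<longlonglongrightarrow> measure (kernel l t x) U" for x
    proof -
      interpret prob_space "kernel l t x" by (rule prob)
      have "(\<lambda>n. \<integral>y. f n y \<partial>kernel l t x) \<longlonglongrightarrow> (\<integral>y. indicator U y \<partial>kernel l t x)"
      proof (rule integral_dominated_convergence[where w="\<lambda>_. 1"])
        show "indicat_real U \<in> borel_measurable (kernel l t x)" using U
          by (auto intro: borel_measurable_indicator)
        show "f n \<in> borel_measurable (kernel l t x)" for n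
          using UC_measurable[OF Lip_b_UC[OF f]] by simp
      qed (use U lim bound in auto)
      then show ?thesis using f Lip_b_UC U by (simp add: S_eq_integral)
    qed
    then have "(\<lambda>x. measure (kernel l t x) U) \<in> borel_measurable borel"
      by (rule borel_measurable_LIMSEQ_real) (intro UC_measurable S_UC l t Lip_b_UC f)
    moreover have "emeasure (kernel l t x) U = ennreal (measure (kernel l t x) U)" for x
    proof -
      interpret prob_space "kernel l t x" by (rule prob)
      show ?thesis by (rule emeasure_eq_measure)
    qed
    ultimately show ?thesis by simp
  qed
qed simp_all

lemma kernel_op_measurable:
  assumes v: "v \<in> borel_measurable borel"
  shows "kernel_op P X l t v \<in> borel_measurable borel"
proof -
  have "(\<lambda>x. \<integral>y. v y \<partial>kernel l t x) \<in> borel_measurable borel"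
    by (rule measurable_compose[OF kernel_measurable integral_measurable_subprob_algebra[OF v]])
  then show ?thesis using v by (subst measurable_cong[OF kernel_op_eq]) auto
qed

end

section \<open>One time step\<close>

text \<open>
  The class of functions that arise as intermediate values of a control: it contains \<open>UC \<kappa>\<close>, is
  closed under \<open>control_op\<close> (\<open>control_op_dominated\<close>), and its members are integrable for every kernel.
\<close>

definition dominated :: "('m \<Rightarrow> real) set" where
  "dominated = {v \<in> borel_measurable borel. \<exists>w\<in>UC \<kappa>. \<forall>x. \<bar>v x\<bar> \<le> w x}"

lemma UC_dominated: "u \<in> UC \<kappa> \<Longrightarrow> u \<in> dominated"
  by (auto simp: dominated_def UC_measurable intro: bexI[OF _ UC_abs])

lemma integrable_dominated:
  assumes "l \<in> \<Lambda>" "t \<ge> 0" "v \<in> dominated"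
  shows "integrable (kernel l t x) v"
proof -
  from assms(3) obtain w where w: "w \<in> UC \<kappa>" "\<And>x. \<bar>v x\<bar> \<le> w x"
    by (auto simp: dominated_def)
  show ?thesis
    by (rule Bochner_Integration.integrable_bound[OF integrable_UC[OF assms(1,2) w(1)]])
      (use assms(3) w(2) in \<open>auto simp: dominated_def intro: order_trans[OF _ abs_ge_self]\<close>)
qed

lemma kernel_op_eq_integral:
  "l \<in> \<Lambda> \<Longrightarrow> t \<ge> 0 \<Longrightarrow> v \<in> dominated \<Longrightarrow> kernel_op P X l t v x = (\<integral>y. v y \<partial>kernel l t x)"
  by (simp add: kernel_op_eq dominated_def)

text \<open>
  The additive constant is kept because the kernels have total mass one; it carries the
  approximation errors through later steps unchanged.
\<close>

lemma kernel_op_mono: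
  assumes "l \<in> \<Lambda>" "t \<ge> 0" "v \<in> dominated" "w \<in> dominated" "\<And>y. v y \<le> w y + c"
  shows "kernel_op P X l t v x \<le> kernel_op P X l t w x + c"
proof -
  interpret prob_space "kernel l t x" using assms(1,2) by (rule prob_space_kernel)
  have "(\<integral>y. v y \<partial>kernel l t x) \<le> (\<integral>y. w y + c \<partial>kernel l t x)"
    using assms by (intro integral_mono) (auto intro: integrable_dominated)
  also have "\<dots> = (\<integral>y. w y \<partial>kernel l t x) + c"
    using assms prob_space by (simp add: integrable_dominated)
  finally show ?thesis using assms by (simp add: kernel_op_eq_integral)
qed

lemma bdd_above_S:
  assumes u: "u \<in> UC \<kappa>" and t: "t \<ge> 0"
  shows "bdd_above ((\<lambda>l. S l t u x) ` \<Lambda>)"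
proof -
  obtain v where v: "v \<in> Lip_b" "\<And>x. \<kappa> x * \<bar>u x - v x\<bar> \<le> 1"
    using u zero_less_one unfolding UC_iff by blast
  obtain B where B: "\<And>x. \<bar>v x\<bar> \<le> B" using v(1) by (auto simp: Lip_b_def bounded_iff)
  have "S l t u x \<le> B + exp (\<alpha> * t) / \<kappa> x" if "l \<in> \<Lambda>" for l
  proof -
    have "\<bar>S l t u x - S l t v x\<bar> \<le> exp (\<alpha> * t) / \<kappa> x"
      using S_weighted_diff[OF that t u v(1) _ v(2), of x] weight_pos[of x]
      by (simp add: field_simps)
    moreover have "\<bar>S l t v x\<bar> \<le> B" using S_bounded[OF that t Lip_b_UC[OF v(1)] B] .
    ultimately show ?thesis by linarith
  qed
  then show ?thesis by (auto simp: bdd_above_def)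
qed

lemma S_le_sup_op: "l \<in> \<Lambda> \<Longrightarrow> t \<ge> 0 \<Longrightarrow> u \<in> UC \<kappa> \<Longrightarrow> S l t u x \<le> sup_op \<Lambda> S t u x"
  unfolding sup_op_def by (rule cSUP_upper[OF _ bdd_above_S])

lemma sup_op_0: "u \<in> UC \<kappa> \<Longrightarrow> sup_op \<Lambda> S 0 u = u"
  using controls_nonempty by (simp add: sup_op_def S_0 fun_eq_iff cong: SUP_cong_simp)

text \<open>
  All \<open>S l t u\<close> share the Lipschitz constant \<open>exp (\<beta> * t) * L\<close> and the bound of \<open>u\<close>, and both pass to
  a pointwise supremum.
\<close>

lemma sup_op_Lip_b:
  assumes u: "u \<in> Lip_b" and t: "t \<ge> 0"
  shows "sup_op \<Lambda> S t u \<in> Lip_b"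
proof -
  obtain L where L: "L-lipschitz_on UNIV u" using u by (auto simp: Lip_b_def)
  obtain B where B: "\<And>x. \<bar>u x\<bar> \<le> B" using u by (auto simp: Lip_b_def bounded_iff)
  have UC: "u \<in> UC \<kappa>" using u by (rule Lip_b_UC)
  have "\<bar>sup_op \<Lambda> S t u x\<bar> \<le> B" for x
    using cSUP_diff_le[OF controls_nonempty bdd_above_S[OF UC t], of "\<lambda>_. 0" x B]
      S_bounded[OF _ t UC B] controls_nonempty by (auto simp: sup_op_def image_constant_conv)
  moreover have "(exp (\<beta> * t) * L)-lipschitz_on UNIV (sup_op \<Lambda> S t u)"
  proof (rule lipschitz_onI)
    fix x y
    show "dist (sup_op \<Lambda> S t u x) (sup_op \<Lambda> S t u y) \<le> exp (\<beta> * t) * L * dist x y"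
      unfolding sup_op_def dist_real_def
      using lipschitz_onD[OF S_lipschitz[OF _ t u L], of _ x y]
      by (intro cSUP_diff_le controls_nonempty bdd_above_S UC t) (auto simp: dist_real_def)
  qed (use lipschitz_on_nonneg[OF L] in simp)
  ultimately show ?thesis by (auto simp: Lip_b_def bounded_iff)
qed

text \<open>
  By \<open>S_weighted_diff\<close>, approximating \<open>u\<close> by \<open>v \<in> Lip_b\<close> with error \<open>e / exp (\<alpha> * t)\<close> approximates
  \<open>sup_op \<Lambda> S t u\<close> by \<open>sup_op \<Lambda> S t v\<close> with error \<open>e\<close>.
\<close>

lemma sup_op_UC:
  assumes u: "u \<in> UC \<kappa>" and t: "t \<ge> 0"
  shows "sup_op \<Lambda> S t u \<in> UC \<kappa>"
  unfolding UC_iff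
proof (intro allI impI)
  fix e :: real assume "e > 0"
  define c where "c = e / exp (\<alpha> * t)"
  have c: "c > 0" using \<open>e > 0\<close> by (simp add: c_def)
  obtain v where v: "v \<in> Lip_b" "\<And>x. \<kappa> x * \<bar>u x - v x\<bar> \<le> c"
    using u c unfolding UC_iff by blast
  have "\<kappa> x * \<bar>sup_op \<Lambda> S t u x - sup_op \<Lambda> S t v x\<bar> \<le> e" for x
  proof -
    have "\<bar>S l t u x - S l t v x\<bar> \<le> e / \<kappa> x" if "l \<in> \<Lambda>" for l
      using S_weighted_diff[OF that t u v(1) _ v(2), of x] c weight_pos[of x]
      by (simp add: c_def field_simps)
    then have "\<bar>sup_op \<Lambda> S t u x - sup_op \<Lambda> S t v x\<bar> \<le> e / \<kappa> x"
      unfolding sup_op_def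
      by (intro cSUP_diff_le controls_nonempty bdd_above_S u t Lip_b_UC v(1))
    then show ?thesis using weight_pos[of x] by (simp add: field_simps)
  qed
  then show "\<exists>v\<in>Lip_b. \<forall>x. \<kappa> x * \<bar>sup_op \<Lambda> S t u x - v x\<bar> \<le> e"
    using sup_op_Lip_b[OF v(1) t] by blast
qed

lemma kernel_op_le_sup_op:
  assumes "l \<in> \<Lambda>" "t \<ge> 0" "v \<in> dominated" "w \<in> UC \<kappa>" "\<And>y. v y \<le> w y"
  shows "kernel_op P X l t v x \<le> sup_op \<Lambda> S t w x"
proof -
  have "kernel_op P X l t v x \<le> kernel_op P X l t w x + 0"
    using assms by (intro kernel_op_mono) (auto intro: UC_dominated)
  also have "\<dots> \<le> sup_op \<Lambda> S t w x"
    using S_le_sup_op assms by (simp flip: S_eq_kernel_op)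
  finally show ?thesis .
qed

lemma control_op_at:
  assumes "c \<in> space_controls \<Lambda>" "x \<in> snd (c i)"
  shows "control_op P X c t v x = kernel_op P X (fst (c i)) t v x"
proof -
  have "indicator (snd (c j)) x * kernel_op P X (fst (c j)) t v x = 0" if "j \<noteq> i" for j
    using assms that by (auto simp: space_controls_def indicator_def)
  then have "control_op P X c t v x
      = (\<Sum>j\<in>{i}. indicator (snd (c j)) x * kernel_op P X (fst (c j)) t v x)"
    unfolding control_op_def by (intro suminf_finite) auto
  then show ?thesis using assms by simp
qed

lemma control_op_cases:
  assumes "c \<in> space_controls \<Lambda>"
  obtains l where "l \<in> \<Lambda>" "\<And>t v. control_op P X c t v x = kernel_op P X l t v x"
proof -
  have "x \<in> (\<Union>i. snd (c i))" using assms by (simp add: space_controls_def)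
  then obtain i where "x \<in> snd (c i)" by auto
  moreover have "fst (c i) \<in> \<Lambda>" using assms by (auto simp: space_controls_def mem_Times_iff)
  ultimately show ?thesis using that control_op_at[OF assms] by blast
qed

lemma control_op_le_sup_op:
  assumes "c \<in> space_controls \<Lambda>" "t \<ge> 0" "v \<in> dominated" "w \<in> UC \<kappa>" "\<And>y. v y \<le> w y"
  shows "control_op P X c t v x \<le> sup_op \<Lambda> S t w x"
  using control_op_cases[OF assms(1), of x] kernel_op_le_sup_op[OF _ assms(2-)] by metis

lemma control_op_mono:
  assumes "c \<in> space_controls \<Lambda>" "t \<ge> 0" "v \<in> dominated" "w \<in> dominated" "\<And>y. v y \<le> w y + a"
  shows "control_op P X c t v x \<le> control_op P X c t w x + a"
  using control_op_cases[OF assms(1), of x] kernel_op_mono[OF _ assms(2-)] by metis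

text \<open>
  If \<open>w \<in> UC \<kappa>\<close> dominates \<open>v\<close>, then \<open>sup_op \<Lambda> S t w \<in> UC \<kappa>\<close> dominates the image of \<open>v\<close> under every control.
\<close>

lemma control_op_dominated:
  assumes c: "c \<in> space_controls \<Lambda>" and t: "t \<ge> 0" and v: "v \<in> dominated"
  shows "control_op P X c t v \<in> dominated"
proof -
  have meas: "v \<in> borel_measurable borel" using v by (simp add: dominated_def)
  have ci: "fst (c i) \<in> \<Lambda>" "snd (c i) \<in> sets borel" for i
    using c by (auto simp: space_controls_def mem_Times_iff)
  have "control_op P X c t v \<in> borel_measurable borel"
    unfolding control_op_def
    using ci by (intro borel_measurable_suminf borel_measurable_times borel_measurable_indicator
        kernel_op_measurable t meas) auto
  moreover from v obtain w where w: "w \<in> UC \<kappa>" "\<And>x. \<bar>v x\<bar> \<le> w x"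
    by (auto simp: dominated_def)
  have "\<bar>control_op P X c t v x\<bar> \<le> sup_op \<Lambda> S t w x" for x
  proof -
    obtain l where l: "l \<in> \<Lambda>" "\<And>t v. control_op P X c t v x = kernel_op P X l t v x"
      using control_op_cases[OF c] by metis
    have neg: "(\<lambda>y. - v y) \<in> dominated" using v by (auto simp: dominated_def)
    have "kernel_op P X l t v x \<le> sup_op \<Lambda> S t w x"
      using w by (intro kernel_op_le_sup_op l t v) (auto simp: abs_le_iff)
    moreover have "kernel_op P X l t (\<lambda>y. - v y) x \<le> sup_op \<Lambda> S t w x"
      using w by (intro kernel_op_le_sup_op l t neg) (auto simp: abs_le_iff)
    moreover have "kernel_op P X l t (\<lambda>y. - v y) x = - kernel_op P X l t v x"
      using l t v neg by (simp add: kernel_op_eq_integral)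
    ultimately show ?thesis using l(2) by simp
  qed
  ultimately show ?thesis using sup_op_UC[OF w(1) t] by (auto simp: dominated_def)
qed

text \<open>
  A measurable selection of nearly optimal controls.  Continuity makes the set \<open>U l\<close> of points at which
  \<open>l\<close> is within \<open>e\<close> of optimal open, and the Lindelof property leaves countably many controls to choose
  from; at each point the first suitable one in an enumeration is used.
\<close>

lemma nearly_optimal_control:
  assumes u: "u \<in> UC \<kappa>" and t: "t \<ge> 0" and e: "e > 0"
  obtains c where "c \<in> space_controls \<Lambda>" "\<And>x. sup_op \<Lambda> S t u x - e \<le> control_op P X c t u x"
proof -
  define U where "U l = {x. sup_op \<Lambda> S t u x - e < S l t u x}" for l
  have open_U: "open (U l)" if "l \<in> \<Lambda>" for l
    unfolding U_def using UC_continuous[OF sup_op_UC[OF u t]] UC_continuous[OF S_UC[OF that t u]]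
    by (intro open_Collect_less continuous_intros)
  have "\<exists>l\<in>\<Lambda>. x \<in> U l" for x
    using less_cSUP_iff[OF controls_nonempty bdd_above_S[OF u t], of "sup_op \<Lambda> S t u x - e" x] e
    by (auto simp: U_def sup_op_def)
  then have cover: "\<Union>(U ` \<Lambda>) = topspace euclidean" by auto
  then obtain \<V> where V: "countable \<V>" "\<V> \<subseteq> U ` \<Lambda>" "\<Union>\<V> = UNIV"
    using Lindelof_spaceD[OF separable_metric_imp_Lindelof[OF separable] _ cover] open_U by auto
  have "\<V> \<noteq> {}" using V(3) by auto
  then have range: "range (from_nat_into \<V>) = \<V>" using V(1) by simp
  have "\<forall>n. \<exists>l\<in>\<Lambda>. from_nat_into \<V> n = U l"
    using V(2) from_nat_into[OF \<open>\<V> \<noteq> {}\<close>] by blast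
  then obtain l where l: "\<And>n. l n \<in> \<Lambda>" "\<And>n. from_nat_into \<V> n = U (l n)" by metis
  define A where "A = (\<lambda>n. U (l n))"
  define c where "c n = (l n, disjointed A n)" for n
  have A: "range A \<subseteq> sets borel" using open_U l(1) by (auto simp: A_def)
  have "disjointed A n \<in> sets borel" for n
    using sets.range_disjointed_sets[OF A] by auto
  moreover have "(\<Union>n. A n) = UNIV"
    using V(3) range l(2) by (simp add: A_def)
  ultimately have c: "c \<in> space_controls \<Lambda>"
    using l(1) disjoint_family_disjointed[of A]
    by (auto simp: space_controls_def c_def UN_disjointed_eq disjoint_family_on_def)
  moreover have "sup_op \<Lambda> S t u x - e \<le> control_op P X c t u x" for x
  proof -
    have "x \<in> (\<Union>n. snd (c n))" using c by (simp add: space_controls_def)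
    then obtain i where i: "x \<in> snd (c i)" by auto
    have "x \<in> U (l i)" using i disjointed_subset[of A i] by (auto simp: c_def A_def)
    then show ?thesis using control_op_at[OF c i] S_eq_kernel_op[OF l(1) t u]
      by (auto simp: U_def c_def[abs_def])
  qed
  ultimately show ?thesis by (rule that)
qed

section \<open>Several time steps and partitions\<close>

text \<open>
  Partitions and controls are compared through their lists of step sizes.
\<close>

abbreviation iterate :: "real list \<Rightarrow> ('m \<Rightarrow> real) \<Rightarrow> 'm \<Rightarrow> real" where
  "iterate hs \<equiv> foldr (sup_op \<Lambda> S) hs"

lemma iterate_UC: "u \<in> UC \<kappa> \<Longrightarrow> \<forall>h\<in>set hs. 0 \<le> h \<Longrightarrow> iterate hs u \<in> UC \<kappa>"
  by (induction hs) (auto intro: sup_op_UC)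

lemma J_op_dominated:
  assumes "u \<in> UC \<kappa>" "set cs \<subseteq> space_controls \<Lambda> \<times> {0..}"
  shows "J_op P X cs u \<in> dominated"
  using assms(2) by (induction cs) (auto intro: control_op_dominated UC_dominated assms(1))

lemma J_op_le_iterate:
  assumes u: "u \<in> UC \<kappa>" and "set cs \<subseteq> space_controls \<Lambda> \<times> {0..}"
  shows "J_op P X cs u x \<le> iterate (map snd cs) u x"
  using assms(2)
proof (induction cs arbitrary: x)
  case (Cons ch cs)
  obtain c h where ch: "ch = (c, h)" by fastforce
  have "control_op P X c h (J_op P X cs u) x \<le> sup_op \<Lambda> S h (iterate (map snd cs) u) x"
    using Cons.prems ch
    by (intro control_op_le_sup_op J_op_dominated iterate_UC u Cons.IH) auto
  then show ?case by (simp add: ch)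
qed simp

text \<open>
  Half of the error is spent on the first step and the other half on the remaining ones, whose error
  is not amplified by the first step.
\<close>

lemma iterate_approximated:
  assumes u: "u \<in> UC \<kappa>" and "\<forall>h\<in>set hs. 0 \<le> h" "e > 0"
  shows "\<exists>cs. map snd cs = hs \<and> set (map fst cs) \<subseteq> space_controls \<Lambda> \<and>
           (\<forall>x. iterate hs u x - e \<le> J_op P X cs u x)"
  using assms(2,3)
proof (induction hs arbitrary: e)
  case Nil
  then show ?case by simp
next
  case (Cons h hs)
  let ?w = "iterate hs u"
  have h: "h \<ge> 0" and w: "?w \<in> UC \<kappa>" using Cons.prems by (auto intro: iterate_UC u)
  obtain cs where cs: "map snd cs = hs" "set (map fst cs) \<subseteq> space_controls \<Lambda>"
    "\<And>x. ?w x - e / 2 \<le> J_op P X cs u x"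
    using Cons.IH[of "e / 2"] Cons.prems by auto
  obtain c where c: "c \<in> space_controls \<Lambda>"
    "\<And>x. sup_op \<Lambda> S h ?w x - e / 2 \<le> control_op P X c h ?w x"
    using nearly_optimal_control[OF w h, of "e / 2"] Cons.prems(2) by auto
  have "set cs \<subseteq> space_controls \<Lambda> \<times> {0..}"
    using cs(1,2) Cons.prems(1) by force
  then have "J_op P X cs u \<in> dominated" by (rule J_op_dominated[OF u])
  then have "control_op P X c h ?w x \<le> control_op P X c h (J_op P X cs u) x + e / 2" for x
    using cs(3) UC_dominated[OF w] by (intro control_op_mono c(1) h) (auto simp: diff_le_eq)
  then have "sup_op \<Lambda> S h ?w x - e \<le> control_op P X c h (J_op P X cs u) x" for x
    using c(2)[of x] by (smt (verit) field_sum_of_halves)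
  then show ?case using cs c(1) by (intro exI[of _ "(c, h) # cs"]) auto
qed

lemma grid_op_eq_iterate:
  assumes "sorted_wrt (<) (s # ts)"
  shows "\<exists>hs. (\<forall>h\<in>set hs. 0 \<le> h) \<and> sum_list hs = last (s # ts) - s \<and>
           grid_op \<Lambda> S (s # ts) u = iterate hs u"
  using assms
proof (induction ts arbitrary: s)
  case Nil
  show ?case by (intro exI[of _ "[]"]) simp
next
  case (Cons r ts)
  then obtain hs where "\<forall>h\<in>set hs. 0 \<le> h" "sum_list hs = last (r # ts) - r"
    "grid_op \<Lambda> S (r # ts) u = iterate hs u" by (metis sorted_wrt.simps(2))
  then show ?case using Cons.prems by (intro exI[of _ "(r - s) # hs"]) auto
qed

text \<open>
  A partition has no repeated points, so steps of length zero are dropped; \<open>sup_op \<Lambda> S 0\<close> is the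
  identity on \<open>UC \<kappa>\<close>.
\<close>

lemma iterate_eq_grid_op:
  assumes u: "u \<in> UC \<kappa>" and "\<forall>h\<in>set hs. 0 \<le> h"
  shows "\<exists>ts. sorted_wrt (<) (s # ts) \<and> last (s # ts) = s + sum_list hs \<and>
           grid_op \<Lambda> S (s # ts) u = iterate hs u"
  using assms(2)
proof (induction hs arbitrary: s)
  case Nil
  show ?case by (intro exI[of _ "[]"]) simp
next
  case (Cons h hs)
  then obtain ts where ts: "sorted_wrt (<) ((s + h) # ts)"
    "last ((s + h) # ts) = s + h + sum_list hs"
    "grid_op \<Lambda> S ((s + h) # ts) u = iterate hs u" by (metis list.set_intros(2))
  show ?case
  proof (cases "h = 0")
    case True
    have "iterate hs u \<in> UC \<kappa>" using u Cons.prems by (intro iterate_UC) auto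
    then show ?thesis using ts True by (intro exI[of _ ts]) (simp add: sup_op_0)
  next
    case False
    then have "h > 0" using Cons.prems by simp
    then show ?thesis using ts by (intro exI[of _ "(s + h) # ts"]) auto
  qed
qed

lemma last_eq_Max:
  fixes s :: real
  assumes "sorted_wrt (<) (s # ts)"
  shows "last (s # ts) = Max (set (s # ts))"
  using assms
proof (induction ts arbitrary: s)
  case (Cons r ts)
  then have "last (r # ts) = Max (set (r # ts))" "s < r" by auto
  moreover have "r \<le> Max (set (r # ts))" by (rule Max_ge) auto
  ultimately show ?case by (simp add: max_def split: if_splits)
qed simp

lemma partition_op_eq_iterate:
  assumes "\<pi> \<in> partitions_upto t"
  obtains hs where "\<forall>h\<in>set hs. 0 \<le> h" "sum_list hs = t" "partition_op \<Lambda> S \<pi> u = iterate hs u"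
proof -
  let ?L = "sorted_list_of_set \<pi>"
  have \<pi>: "finite \<pi>" "\<pi> \<subseteq> {0..}" "0 \<in> \<pi>" "Max \<pi> = t"
    using assms by (auto simp: partitions_upto_def partitions_def)
  then have "\<pi> \<noteq> {}" by auto
  have "Min \<pi> = 0" using \<pi> by (intro Min_eqI) auto
  then obtain ts where L: "?L = 0 # ts"
    using sorted_list_of_set_nonempty[OF \<pi>(1) \<open>\<pi> \<noteq> {}\<close>] by simp
  have sorted: "sorted_wrt (<) (0 # ts)"
    using strict_sorted_list_of_set[of \<pi>] L by simp
  have "last (0 # ts) = t"
    using last_eq_Max[OF sorted] \<pi> by (simp flip: L)
  then show ?thesis
    using grid_op_eq_iterate[OF sorted, of u] that by (auto simp: partition_op_def L)
qed

lemma iterate_eq_partition_op: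
  assumes u: "u \<in> UC \<kappa>" and hs: "\<forall>h\<in>set hs. 0 \<le> h" and t: "sum_list hs = t"
  obtains \<pi> where "\<pi> \<in> partitions_upto t" "partition_op \<Lambda> S \<pi> u = iterate hs u"
proof -
  obtain ts where ts: "sorted_wrt (<) (0 # ts)" "last (0 # ts) = t"
    "grid_op \<Lambda> S (0 # ts) u = iterate hs u"
    using iterate_eq_grid_op[OF u hs, of 0] t by auto
  let ?\<pi> = "set (0 # ts)"
  have "sorted_list_of_set ?\<pi> = 0 # ts"
    using ts(1) by (intro sorted_list_of_set.idem_if_sorted_distinct) (auto simp: strict_sorted_iff)
  moreover have "?\<pi> \<in> partitions_upto t"
    using last_eq_Max[OF ts(1)] ts(1,2) by (auto simp: partitions_upto_def partitions_def less_imp_le)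
  ultimately show ?thesis using ts(3) that by (simp add: partition_op_def)
qed

theorem semigroup_envelope_eq_SUP_J_op:
  assumes u: "u \<in> UC \<kappa>" and t: "t \<ge> 0"
  shows "semigroup_envelope \<Lambda> S t u x = (SUP c\<in>admissible_controls \<Lambda> t. J_op P X c u x)"
  unfolding semigroup_envelope_def
proof (rule Sup_eq_Sup_if_mutually_approximating, goal_cases)
  case (1 b)
  then obtain cs where cs: "cs \<in> admissible_controls \<Lambda> t" "b = J_op P X cs u x" by auto
  have sub: "set cs \<subseteq> space_controls \<Lambda> \<times> {0..}" and sum: "sum_list (map snd cs) = t"
    using cs(1) by (auto simp: admissible_controls_def)
  have "\<forall>h\<in>set (map snd cs). 0 \<le> h" using sub by auto
  then obtain \<pi> where \<pi>: "\<pi> \<in> partitions_upto t" "partition_op \<Lambda> S \<pi> u = iterate (map snd cs) u"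
    using iterate_eq_partition_op[OF u _ sum] by blast
  have "b \<le> partition_op \<Lambda> S \<pi> u x" using J_op_le_iterate[OF u sub] cs(2) \<pi>(2) by simp
  then show ?case using \<pi>(1) by blast
next
  case (2 a e)
  then obtain \<pi> where \<pi>: "\<pi> \<in> partitions_upto t" "a = partition_op \<Lambda> S \<pi> u x" by auto
  obtain hs where hs: "\<forall>h\<in>set hs. 0 \<le> h" "sum_list hs = t" "a = iterate hs u x"
    using partition_op_eq_iterate[OF \<pi>(1)] \<pi>(2) by metis
  \<comment> \<open>For \<open>t = 0\<close> the list \<open>hs\<close> may be empty whereas an admissible control has at least one step;
    a leading step of length zero covers this case.\<close>
  have hs0: "\<forall>h\<in>set (0 # hs). 0 \<le> h" using hs(1) by simp
  have "a = iterate (0 # hs) u x" using hs by (simp add: sup_op_0 iterate_UC u)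
  then obtain cs where cs: "map snd cs = 0 # hs" "set (map fst cs) \<subseteq> space_controls \<Lambda>"
    "a - e \<le> J_op P X cs u x"
    using iterate_approximated[OF u hs0 2(2)] by metis
  have "h \<le> t" if "h \<in> set (0 # hs)" for h
    using member_le_sum_list[of h "0 # hs"] hs0 hs(2) that by simp
  then have "\<forall>h\<in>snd ` set cs. 0 \<le> h \<and> h \<le> t"
    using hs0 by (metis cs(1) list.set_map)
  then have "cs \<in> admissible_controls \<Lambda> t"
    using cs(1,2) hs(2) by (auto simp: admissible_controls_def subset_iff)
  then show ?case using cs(3) by blast
qed

end

theorem mainTheorem9:
  fixes \<kappa> :: "'m::metric_space \<Rightarrow> real"
    and \<Lambda> :: "'l set"
    and S :: "'l \<Rightarrow> real \<Rightarrow> ('m \<Rightarrow> real) \<Rightarrow> 'm \<Rightarrow> real"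
    and \<alpha> \<beta> :: real
    and P :: "'l \<Rightarrow> real \<Rightarrow> 'm \<Rightarrow> 'w measure"
    and X :: "'l \<Rightarrow> real \<Rightarrow> 'm \<Rightarrow> 'w \<Rightarrow> 'm"
  assumes "separable_space (euclidean :: 'm topology)"
    and "\<Lambda> \<noteq> {}"
    and "continuous_on UNIV \<kappa>" and "bounded (range \<kappa>)" and "\<forall>x. 0 < \<kappa> x"
    and "\<forall>l\<in>\<Lambda>. feller_semigroup \<kappa> (S l)"
    and "\<forall>l\<in>\<Lambda>. \<forall>t\<ge>0. UC_linear \<kappa> (S l t)"
    and "\<forall>l\<in>\<Lambda>. \<forall>t\<ge>0. S l t (\<lambda>x. 1) = (\<lambda>x. 1)"
    and "\<forall>l\<in>\<Lambda>. \<forall>t\<ge>0. \<forall>u\<in>Lip_b. wnorm \<kappa> (S l t u) \<le> ennreal (exp (\<alpha> * t)) * wnorm \<kappa> u"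
    and "\<forall>l\<in>\<Lambda>. \<forall>t\<ge>0. \<forall>u\<in>Lip_b. lip_norm (S l t u) \<le> ennreal (exp (\<beta> * t)) * lip_norm u"
    and "represented_by \<kappa> \<Lambda> S P X"
  shows "\<forall>t\<ge>0. \<forall>u\<in>UC \<kappa>. \<forall>x.
           semigroup_envelope \<Lambda> S t u x = (SUP c\<in>admissible_controls \<Lambda> t. J_op P X c u x)"
proof -
  interpret linear_feller_family \<kappa> \<Lambda> S \<alpha> \<beta> P X
    using assms by unfold_locales auto
  show ?thesis by (auto intro: semigroup_envelope_eq_SUP_J_op)
qed

end
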